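(* There exists a finite skew brace $B$ whose additive group $(B,+)$ is isomorphic to $\operatorname{SL}(2,5)$ such that $B$ is quasi-simple, $B$ is not two-sided, and $B$ is neither trivial nor almost trivial.
   Context: A skew brace is a triple $(B,+,\cdot)$ such that $(B,+)$ and $(B,\cdot)$ are groups (neither assumed abelian) and $a\cdot(b+c)=a\cdot b-a+a\cdot c$ for all $a,b,c\in B$; both groups have the same identity, denoted $0$. It is two-sided if moreover $(a+b)c=ac-c+bc$ for all $a,b,c\in B$. For $b\in B$ put $\lambda_b(a)=-b+ba$. A subset $I\subseteq B$ is an ideal if $(I,+)\trianglelefteq(B,+)$, $(I,\cdot)\trianglelefteq(B,\cdot)$ and $\lambda_b(I)\subseteq I$ for all $b\in B$; then $a+I=aI$ for all $a\in B$ and $B/I$ is a skew brace. The center $Z(B)$ is the set of $z\in B$ that are central in both $(B,+)$ and $(B,\cdot)$ and satisfy $\lambda_z=\operatorname{id}_B$; it is an ideal. A skew brace is simple if it is non-zero and its only ideals are $0$ and itself. The commutator ideal $[B,B]^B$ is the ideal of $B$ generated by the additive commutators, the multiplicative commutators and the elements $ab-(a+b)$, $a,b\in B$. The skew brace $B$ is perfect if $B=[B,B]^B$, and quasi-simple if $B$ is perfect and $B/Z(B)$ is simple. A skew brace $B$ is trivial if $ab=a+b$ for all $a,b\in B$, and almost trivial if $ab=b+a$ for all $a,b\in B$. $\operatorname{SL}(2,5)$ is the group of $2\times 2$ matrices of determinant $1$ over the field with $5$ elements. *)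

theory Defs
  imports "HOL-Algebra.QuotRing" "HOL-Algebra.Generated_Groups" "HOL-Analysis.Determinants"
begin

text \<open>
  A skew brace is carried by the record type \<open>'a ring\<close> of HOL-Algebra: the additive group
  is \<open>add_monoid B\<close> and the multiplicative group is \<open>B\<close> itself viewed as a monoid
  record. Only the record is reused; \<open>B\<close> is not a ring. The library notations
  \<open>\<ominus> a\<close> and \<open>a \<ominus> b = a \<oplus> (\<ominus> b)\<close> are meaningful for
  a non-abelian additive group.
\<close>

locale skew_brace =
  fixes B (structure)
  assumes add_group: "group (add_monoid B)"
    and mult_group: "group B"
    and brace_law: "\<And>a b c. \<lbrakk>a \<in> carrier B; b \<in> carrier B; c \<in> carrier B\<rbrakk> \<Longrightarrow>
      a \<otimes> (b \<oplus> c) = ((a \<otimes> b) \<ominus> a) \<oplus> (a \<otimes> c)"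

text \<open>The two identities, separate fields of the record, agree.\<close>

lemma (in skew_brace) one_eq_zero: "\<one> = \<zero>"
proof -
  interpret A: group "add_monoid B" by (rule add_group)
  interpret M: group B by (rule mult_group)
  have z: "\<zero> \<in> carrier B" using A.one_closed by simp
  have zz: "\<zero> \<oplus> \<zero> = \<zero>" using A.l_one[of \<zero>] z by simp
  have "\<one> \<otimes> (\<zero> \<oplus> \<zero>) = ((\<one> \<otimes> \<zero>) \<ominus> \<one>) \<oplus> (\<one> \<otimes> \<zero>)"
    using z by (intro brace_law) auto
  hence "\<zero> = (\<zero> \<ominus> \<one>) \<oplus> \<zero>" using z zz by simp
  also have "\<dots> = \<ominus> \<one>"
    using A.inv_closed[of \<one>] A.l_one[of "\<ominus> \<one>"] A.r_one[of "\<ominus> \<one>"]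
    by (simp add: a_minus_def a_inv_def)
  finally show ?thesis
    using A.r_inv[of \<one>] A.r_one[of \<one>] by (simp add: a_inv_def)
qed

definition brace_lambda :: "('a, 'm) ring_scheme \<Rightarrow> 'a \<Rightarrow> 'a \<Rightarrow> 'a" where
  "brace_lambda B b a = (\<ominus>\<^bsub>B\<^esub> b) \<oplus>\<^bsub>B\<^esub> (b \<otimes>\<^bsub>B\<^esub> a)"

definition two_sided :: "('a, 'm) ring_scheme \<Rightarrow> bool" where
  "two_sided B \<longleftrightarrow> (\<forall>a\<in>carrier B. \<forall>b\<in>carrier B. \<forall>c\<in>carrier B.
     (a \<oplus>\<^bsub>B\<^esub> b) \<otimes>\<^bsub>B\<^esub> c
       = ((a \<otimes>\<^bsub>B\<^esub> c) \<ominus>\<^bsub>B\<^esub> c) \<oplus>\<^bsub>B\<^esub> (b \<otimes>\<^bsub>B\<^esub> c))"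

definition trivial_brace :: "('a, 'm) ring_scheme \<Rightarrow> bool" where
  "trivial_brace B \<longleftrightarrow>
     (\<forall>a\<in>carrier B. \<forall>b\<in>carrier B. a \<otimes>\<^bsub>B\<^esub> b = a \<oplus>\<^bsub>B\<^esub> b)"

definition almost_trivial_brace :: "('a, 'm) ring_scheme \<Rightarrow> bool" where
  "almost_trivial_brace B \<longleftrightarrow>
     (\<forall>a\<in>carrier B. \<forall>b\<in>carrier B. a \<otimes>\<^bsub>B\<^esub> b = b \<oplus>\<^bsub>B\<^esub> a)"

definition brace_ideal :: "'a set \<Rightarrow> ('a, 'm) ring_scheme \<Rightarrow> bool" where
  "brace_ideal I B \<longleftrightarrow> I \<lhd> add_monoid B \<and> I \<lhd> B \<and>
     (\<forall>b\<in>carrier B. brace_lambda B b ` I \<subseteq> I)"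

definition brace_center :: "('a, 'm) ring_scheme \<Rightarrow> 'a set" where
  "brace_center B = {z \<in> carrier B. \<forall>a\<in>carrier B.
     z \<oplus>\<^bsub>B\<^esub> a = a \<oplus>\<^bsub>B\<^esub> z \<and> z \<otimes>\<^bsub>B\<^esub> a = a \<otimes>\<^bsub>B\<^esub> z \<and>
     brace_lambda B z a = a}"

definition brace_ideal_generated :: "('a, 'm) ring_scheme \<Rightarrow> 'a set \<Rightarrow> 'a set" where
  "brace_ideal_generated B S = \<Inter>{I. brace_ideal I B \<and> S \<subseteq> I}"

text \<open>
  The library's \<open>derived_set\<close> uses the convention \<open>[a,b] = a b a\<^sup>-\<^sup>1 b\<^sup>-\<^sup>1\<close>;
  the generated ideal does not depend on that choice.
\<close>

definition commutator_ideal :: "('a, 'm) ring_scheme \<Rightarrow> 'a set" where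
  "commutator_ideal B = brace_ideal_generated B
     (derived_set (add_monoid B) (carrier B) \<union> derived_set B (carrier B) \<union>
      {(a \<otimes>\<^bsub>B\<^esub> b) \<ominus>\<^bsub>B\<^esub> (a \<oplus>\<^bsub>B\<^esub> b) | a b. a \<in> carrier B \<and> b \<in> carrier B})"

definition perfect_brace :: "('a, 'm) ring_scheme \<Rightarrow> bool" where
  "perfect_brace B \<longleftrightarrow> commutator_ideal B = carrier B"

locale simple_skew_brace = skew_brace +
  assumes nonzero: "carrier B \<noteq> {\<zero>}"
    and ideals_trivial: "\<And>I. brace_ideal I B \<Longrightarrow> I = {\<zero>} \<or> I = carrier B"

text \<open>
  For the quotient skew brace the library's \<open>B Quot I\<close> is used: its elements are the additive
  cosets \<open>I + a\<close>, which for an ideal \<open>I\<close> are also the multiplicative ones, and both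
  operations are induced from representatives.
\<close>

locale quasi_simple_skew_brace = skew_brace +
  assumes perfect: "perfect_brace B"
    and simple_quotient: "simple_skew_brace (B Quot brace_center B)"

definition special_linear_group :: "('a :: comm_ring_1 ^ 'n ^ 'n) monoid" where
  "special_linear_group = \<lparr>carrier = {A. det A = 1}, monoid.mult = (**), one = mat 1\<rparr>"

text \<open>
  The numeral type \<open>5\<close> is the ring of integers modulo 5. It has no instance of the class
  \<open>field\<close>, but it is the field with five elements:
\<close>

lemma five_field:
  fixes x :: 5
  assumes "x \<noteq> 0"
  shows "\<exists>y. x * y = 1"
proof (cases x rule: bit1_cases)
  case (of_int z)
  hence "z \<in> {0, 1, 2, 3, 4}" by auto
  with of_int assms have "x = 1 \<or> x = 2 \<or> x = 3 \<or> x = 4" by auto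
  moreover have "(1 :: 5) * 1 = 1" "(2 :: 5) * 3 = 1" "(3 :: 5) * 2 = 1" "(4 :: 5) * 4 = 1"
    by simp_all
  ultimately show ?thesis by blast
qed

abbreviation SL_2_5 :: "(5 ^ 2 ^ 2) monoid" where
  "SL_2_5 \<equiv> special_linear_group"

end

theory Submission
  imports Defs
begin

text \<open>
  A group \<open>G\<close> with an exact factorization \<open>G = H K\<close>, \<open>H \<inter> K = 1\<close>, becomes a skew brace with
  additive group \<open>G\<close> under \<open>(h k) \<circ> b = h b k\<close>. Take \<open>G = SL(2,5)\<close>, let \<open>K\<close> be the group of upper
  unitriangular matrices, which is the stabilizer of the first basis vector, and let \<open>H\<close> be the
  normalizer of the quaternion group, a copy of \<open>SL(2,3)\<close> that acts regularly on the 24 nonzero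
  vectors. Every central element of \<open>G\<close> lies in \<open>H\<close> and so is central in the brace. Every normal
  subgroup of \<open>G\<close> is central or all of \<open>G\<close>, so the additive group alone already makes the brace
  quasi-simple.
\<close>

section \<open>The center of a skew brace and the quotient by it\<close>

sublocale skew_brace \<subseteq> add: group "add_monoid B"
  rewrites "carrier (add_monoid B) = carrier B"
    and "monoid.mult (add_monoid B) = (\<oplus>)"
    and "one (add_monoid B) = \<zero>"
    and "m_inv (add_monoid B) = a_inv B"
  by (rule add_group) (auto simp: a_inv_def)

sublocale skew_brace \<subseteq> group B
  by (rule mult_group)

context skew_brace
begin

text \<open>Adding \<open>z\<close> on the left turns -z + za = a into za = z + a. In this form a
  central element acts by the same translation in both groups, which drives the later
  computations.\<close>

lemma brace_center_iff:
  "z \<in> brace_center B \<longleftrightarrow> z \<in> carrier B \<and>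
     (\<forall>a\<in>carrier B. z \<oplus> a = a \<oplus> z \<and> z \<otimes> a = a \<otimes> z \<and> z \<otimes> a = z \<oplus> a)"
proof -
  have "brace_lambda B z a = a \<longleftrightarrow> z \<otimes> a = z \<oplus> a" if "z \<in> carrier B" "a \<in> carrier B" for a
    using that unfolding brace_lambda_def
    by (metis add.inv_solve_left m_closed)
  then show ?thesis unfolding brace_center_def by blast
qed

lemma
  assumes "z \<in> brace_center B"
  shows brace_center_closed: "z \<in> carrier B"
    and brace_center_add_commute: "a \<in> carrier B \<Longrightarrow> a \<oplus> z = z \<oplus> a"
    and brace_center_mult_commute: "a \<in> carrier B \<Longrightarrow> a \<otimes> z = z \<oplus> a"
    and brace_center_mult_eq_add: "a \<in> carrier B \<Longrightarrow> z \<otimes> a = z \<oplus> a"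
  using assms by (auto simp: brace_center_iff)

lemma brace_center_add_mem:
  assumes z: "z \<in> brace_center B" and w: "w \<in> brace_center B"
  shows "z \<oplus> w \<in> brace_center B"
proof -
  have zw: "z \<in> carrier B" "w \<in> carrier B"
    using z w by (auto dest: brace_center_closed)
  have "(z \<oplus> w) \<oplus> a = a \<oplus> (z \<oplus> w)" if "a \<in> carrier B" for a
    using that zw z w by (metis add.m_assoc brace_center_add_commute)
  moreover have "(z \<oplus> w) \<otimes> a = (z \<oplus> w) \<oplus> a" if a: "a \<in> carrier B" for a
  proof -
    have "(z \<oplus> w) \<otimes> a = z \<otimes> (w \<otimes> a)"
      using zw a z by (metis brace_center_mult_eq_add m_assoc)
    also have "\<dots> = z \<oplus> (w \<oplus> a)"
      using zw a z w by (simp add: brace_center_mult_eq_add)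
    finally show ?thesis using zw a by (simp add: add.m_assoc)
  qed
  moreover have "a \<otimes> (z \<oplus> w) = (z \<oplus> w) \<oplus> a" if a: "a \<in> carrier B" for a
  proof -
    have "a \<otimes> (z \<oplus> w) = (a \<otimes> z) \<otimes> w"
      using zw a z by (metis brace_center_mult_eq_add m_assoc)
    also have "\<dots> = w \<oplus> (z \<oplus> a)"
      using zw a z w by (simp add: brace_center_mult_commute)
    also have "\<dots> = (z \<oplus> w) \<oplus> a"
      using zw a z w by (metis add.m_assoc brace_center_add_commute)
    finally show ?thesis .
  qed
  ultimately show ?thesis using zw by (auto simp: brace_center_iff)
qed

text \<open>Since (-z)z = z + (-z) = 0 and the two identities agree, \<open>\<ominus> z\<close> is
  also the multiplicative inverse of \<open>z\<close>. The laws for \<open>\<ominus> z\<close> are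
  then those for \<open>z\<close>, solved for the other side.\<close>

lemma brace_center_minus_mem:
  assumes z: "z \<in> brace_center B"
  shows "\<ominus> z \<in> brace_center B"
proof -
  have zc: "z \<in> carrier B" using z by (rule brace_center_closed)
  have inv_z: "inv z = \<ominus> z"
    using zc z by (metis add.inv_closed add.r_inv one_eq_zero inv_equality brace_center_mult_commute)
  have comm: "\<ominus> z \<oplus> a = a \<oplus> \<ominus> z" if a: "a \<in> carrier B" for a
  proof -
    have "z \<oplus> (a \<oplus> \<ominus> z) = (a \<oplus> z) \<oplus> \<ominus> z"
      using zc a by (simp add: brace_center_add_commute[OF z] add.m_assoc)
    also have "\<dots> = a" using zc a by (simp add: add.m_assoc)
    finally show ?thesis using zc a by (simp add: add.inv_solve_left')
  qed
  have left: "\<ominus> z \<otimes> a = \<ominus> z \<oplus> a" if a: "a \<in> carrier B" for a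
  proof -
    have "z \<otimes> (\<ominus> z \<oplus> a) = a"
      using zc a z by (simp add: brace_center_mult_eq_add flip: add.m_assoc)
    then show ?thesis
      using zc a by (metis inv_z add.inv_closed add.m_closed inv_solve_left)
  qed
  have right: "a \<otimes> \<ominus> z = \<ominus> z \<oplus> a" if a: "a \<in> carrier B" for a
  proof -
    have "(\<ominus> z \<oplus> a) \<otimes> z = a"
      using zc a z by (simp add: brace_center_mult_commute flip: add.m_assoc)
    then show ?thesis
      using zc a by (metis inv_z add.inv_closed add.m_closed inv_solve_right)
  qed
  show ?thesis using zc comm left right by (simp add: brace_center_iff)
qed

lemma zero_in_brace_center: "\<zero> \<in> brace_center B"
proof -
  have "\<zero> \<otimes> a = a" "a \<otimes> \<zero> = a" if "a \<in> carrier B" for a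
    using that by (metis l_one one_eq_zero) (use that in \<open>metis r_one one_eq_zero\<close>)
  then show ?thesis unfolding brace_center_iff by (metis add.l_one add.one_closed add.r_one)
qed

lemma brace_center_normal: "brace_center B \<lhd> add_monoid B"
proof (rule group.normal_invI[OF add_group])
  show "subgroup (brace_center B) (add_monoid B)"
    using zero_in_brace_center
    by unfold_locales
      (auto simp: brace_center_add_mem brace_center_minus_mem a_inv_def[symmetric]
        dest: brace_center_closed)
next
  fix x z assume x: "x \<in> carrier (add_monoid B)" and z: "z \<in> brace_center B"
  then have "x \<oplus> z \<oplus> \<ominus> x = z"
    by (simp add: brace_center_add_commute[OF z]) (simp add: add.m_assoc brace_center_closed)
  then show "x \<otimes>\<^bsub>add_monoid B\<^esub> z \<otimes>\<^bsub>add_monoid B\<^esub> inv\<^bsub>add_monoid B\<^esub> x \<in> brace_center B"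
    using z by (simp add: a_inv_def)
qed

text \<open>Elements of the center act by the same translations in both groups, so both operations
  pass to additive cosets of the center.\<close>

lemma brace_center_quotient:
  defines "q \<equiv> (+>) (brace_center B)" and "Q \<equiv> B Quot brace_center B"
  shows skew_brace_quotient_center: "skew_brace Q"
    and quotient_center_add_hom: "group_hom (add_monoid B) (add_monoid Q) q"
    and quotient_center_surj: "carrier Q = q ` carrier B"
proof -
  interpret Z: normal "brace_center B" "add_monoid B" by (rule brace_center_normal)
  have q_def': "q a = brace_center B #>\<^bsub>add_monoid B\<^esub> a" for a
    by (simp add: q_def a_r_coset_def)
  have carrier_Q: "carrier Q = q ` carrier B"
    by (auto simp: Q_def FactRing_def A_RCOSETS_def RCOSETS_def q_def')
  have q_add: "q (a \<oplus> b) = q a \<oplus>\<^bsub>Q\<^esub> q b" if "a \<in> carrier B" "b \<in> carrier B" for a b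
    using that Z.rcos_sum[of a b] by (simp add: Q_def FactRing_def q_def' set_add_def)
  have q_eq: "q (z \<oplus> a) = q a" if z: "z \<in> brace_center B" and a: "a \<in> carrier B" for z a
    using z a add.coset_mult_assoc[of "brace_center B" z a] Z.subset
      add.coset_join2[OF brace_center_closed Z.subgroup_axioms z, OF z]
    by (simp add: q_def' brace_center_closed)
  have q_mult: "q (a \<otimes> b) = q a \<otimes>\<^bsub>Q\<^esub> q b" if a: "a \<in> carrier B" and b: "b \<in> carrier B" for a b
  proof -
    \<comment> \<open>The product in \<open>B Quot I\<close> is a union over all pairs of
      representatives. It collapses to a single coset once independence of the representatives is
      known.\<close>
    have "q (a' \<otimes> b') = q (a \<otimes> b)" if "a' \<in> q a" "b' \<in> q b" for a' b'
    proof -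
      from that obtain z w where zw: "z \<in> brace_center B" "w \<in> brace_center B"
        and a': "a' = z \<oplus> a" and b': "b' = w \<oplus> b"
        by (auto simp: q_def' r_coset_def)
      note zwc = zw[THEN brace_center_closed]
      \<comment> \<open>The central \<open>w\<close> moves past \<open>b\<close> to the right and
        \<open>z\<close> moves out to the left; both then turn into left additive
        translations.\<close>
      have "a' \<otimes> b' = z \<otimes> (a \<otimes> (b \<otimes> w))"
        using a b zw zwc unfolding a' b'
        by (metis brace_center_mult_commute brace_center_mult_eq_add m_assoc m_closed)
      also have "\<dots> = z \<oplus> (w \<oplus> (a \<otimes> b))"
        using a b zwc brace_center_mult_eq_add[OF zw(1), of "a \<otimes> b \<otimes> w"]
          brace_center_mult_commute[OF zw(2), of "a \<otimes> b"]
        by (simp add: m_assoc)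
      finally show ?thesis
        using a b zw zwc by (simp add: q_eq)
    qed
    moreover have "a \<in> q a" "b \<in> q b"
      using a b Z.subgroup_axioms by (auto simp: q_def' intro: add.rcos_self)
    ultimately have "(\<Union>a'\<in>q a. \<Union>b'\<in>q b. q (a' \<otimes> b')) = q (a \<otimes> b)"
      by blast
    then show ?thesis
      by (simp add: Q_def FactRing_def rcoset_mult_def q_def)
  qed
  have q_zero: "q \<zero> = \<zero>\<^bsub>Q\<^esub>"
    using Z.subset by (simp add: q_def' Q_def FactRing_def add.coset_mult_one)
  have q_one: "q \<one> = \<one>\<^bsub>Q\<^esub>"
    by (simp add: q_def Q_def FactRing_def)
  have add_hom: "q \<in> hom (add_monoid B) (add_monoid Q)"
    using carrier_Q q_add by (intro homI) auto
  have mult_hom: "q \<in> hom B Q"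
    using carrier_Q q_mult by (intro homI) auto
  have add_Q: "group (add_monoid Q)"
    using group.hom_imp_img_group[OF add_group add_hom] carrier_Q q_zero
    by simp
  have mult_Q: "group Q"
  proof -
    \<comment> \<open>\<open>hom_imp_img_group\<close> speaks of \<open>Q\<close> with carrier and
      unit replaced by the images under \<open>q\<close>; both replacements leave \<open>Q\<close>
      unchanged.\<close>
    have "Q\<lparr>carrier := carrier Q\<rparr> = Q" by (simp add: Q_def FactRing_def)
    then show ?thesis
      using hom_imp_img_group[OF mult_hom] by (simp flip: carrier_Q add: q_one)
  qed
  show hom: "group_hom (add_monoid B) (add_monoid Q) q"
    by (intro group_hom.intro group_hom_axioms.intro add_group add_Q add_hom)
  have q_a_inv: "q (\<ominus> b) = \<ominus>\<^bsub>Q\<^esub> q b" if "b \<in> carrier B" for b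
    using that group_hom.hom_inv[OF hom, of b] by (simp add: a_inv_def)
  have q_minus: "q (a \<ominus> b) = q a \<ominus>\<^bsub>Q\<^esub> q b" if "a \<in> carrier B" "b \<in> carrier B" for a b
    using that by (simp add: a_minus_def q_add q_a_inv)
  show "carrier Q = q ` carrier B" by (rule carrier_Q)
  show "skew_brace Q"
  proof (rule skew_brace.intro[OF add_Q mult_Q])
    fix A' B' C' assume "A' \<in> carrier Q" "B' \<in> carrier Q" "C' \<in> carrier Q"
    then obtain a b c where abc: "a \<in> carrier B" "b \<in> carrier B" "c \<in> carrier B"
      and eqs: "A' = q a" "B' = q b" "C' = q c"
      unfolding carrier_Q by blast
    have cl: "a \<otimes> b \<ominus> a \<in> carrier B" using abc by (simp add: a_minus_def)
    have "q (a \<otimes> (b \<oplus> c)) = q ((a \<otimes> b \<ominus> a) \<oplus> a \<otimes> c)"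
      using abc by (simp add: brace_law)
    then show "A' \<otimes>\<^bsub>Q\<^esub> (B' \<oplus>\<^bsub>Q\<^esub> C') = A' \<otimes>\<^bsub>Q\<^esub> B' \<ominus>\<^bsub>Q\<^esub> A' \<oplus>\<^bsub>Q\<^esub> A' \<otimes>\<^bsub>Q\<^esub> C'"
      using abc cl unfolding eqs by (simp add: q_add q_mult q_minus)
  qed
qed

section \<open>Quasi-simplicity from the normal subgroups of the additive group\<close>

lemma carrier_brace_ideal: "brace_ideal (carrier B) B"
  unfolding brace_ideal_def
proof (intro conjI ballI)
  show "carrier B \<lhd> add_monoid B"
    using add.subgroup_self by (intro group.normal_invI[OF add_group]) (auto simp: a_inv_def[symmetric])
  show "carrier B \<lhd> B" using subgroup_self by (intro normal_invI) auto
  show "brace_lambda B b ` carrier B \<subseteq> carrier B" if "b \<in> carrier B" for b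
    using that by (auto simp: brace_lambda_def)
qed

text \<open>An ideal containing the generators of the commutator ideal contains a noncentral
  additive commutator. As an additive normal subgroup outside the center, it is everything.\<close>

lemma perfect_braceI:
  assumes normal: "\<And>N. N \<lhd> add_monoid B \<Longrightarrow> N \<subseteq> brace_center B \<or> N = carrier B"
    and xy: "x \<in> carrier B" "y \<in> carrier B"
    and noncentral: "x \<oplus> y \<oplus> \<ominus> x \<oplus> \<ominus> y \<notin> brace_center B"
  shows "perfect_brace B"
proof -
  let ?S = "derived_set (add_monoid B) (carrier B) \<union> derived_set B (carrier B) \<union>
      {(a \<otimes> b) \<ominus> (a \<oplus> b) | a b. a \<in> carrier B \<and> b \<in> carrier B}"
  have "?S \<subseteq> carrier B"
    by (auto simp: a_minus_def a_inv_def[symmetric])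
  moreover have "I = carrier B" if I: "brace_ideal I B" "?S \<subseteq> I" for I
  proof -
    have "x \<oplus> y \<oplus> \<ominus> x \<oplus> \<ominus> y \<in> derived_set (add_monoid B) (carrier B)"
      by (intro UN_I[OF xy(1)] UN_I[OF xy(2)]) (simp add: a_inv_def)
    moreover have "derived_set (add_monoid B) (carrier B) \<subseteq> I"
      using I(2) by (simp only: Un_subset_iff)
    ultimately have "x \<oplus> y \<oplus> \<ominus> x \<oplus> \<ominus> y \<in> I" by (rule rev_subsetD)
    then have "\<not> I \<subseteq> brace_center B" using noncentral by (metis subsetD)
    then show ?thesis using I(1) normal by (auto simp: brace_ideal_def)
  qed
  ultimately have "\<Inter>{I. brace_ideal I B \<and> ?S \<subseteq> I} = carrier B"
    using carrier_brace_ideal by blast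
  then show ?thesis
    by (simp only: perfect_brace_def commutator_ideal_def brace_ideal_generated_def)
qed

text \<open>The preimage of an ideal under the quotient map is an additive normal subgroup. If it is
  central, the ideal is zero; if it is everything, so is the ideal, by surjectivity.\<close>

lemma simple_quotient_centerI:
  assumes normal: "\<And>N. N \<lhd> add_monoid B \<Longrightarrow> N \<subseteq> brace_center B \<or> N = carrier B"
    and nontrivial: "brace_center B \<noteq> carrier B"
  shows "simple_skew_brace (B Quot brace_center B)"
proof -
  define q where "q = (+>) (brace_center B)"
  define Q where "Q = B Quot brace_center B"
  note quotient = brace_center_quotient[folded q_def Q_def]
  interpret q: group_hom "add_monoid B" "add_monoid Q" q by (rule quotient(2))
  interpret Z: normal "brace_center B" "add_monoid B" by (rule brace_center_normal)
  have zero_Q: "\<zero>\<^bsub>Q\<^esub> = brace_center B" by (simp add: Q_def FactRing_def)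
  have q_mem: "a \<in> q a" if "a \<in> carrier B" for a
    using that Z.subgroup_axioms by (auto simp: q_def a_r_coset_def intro: add.rcos_self)
  have q_zero_iff: "q a = \<zero>\<^bsub>Q\<^esub> \<longleftrightarrow> a \<in> brace_center B" if a: "a \<in> carrier B" for a
    using a q_mem[OF a] Z.subgroup_axioms add.coset_join2[of a "brace_center B"]
    by (auto simp: zero_Q q_def a_r_coset_def)
  show ?thesis unfolding Q_def[symmetric]
  proof (intro simple_skew_brace.intro simple_skew_brace_axioms.intro quotient(1))
    obtain a where "a \<in> carrier B" "a \<notin> brace_center B"
      using nontrivial by (auto dest: brace_center_closed)
    then have "q a \<in> carrier Q" "q a \<noteq> \<zero>\<^bsub>Q\<^esub>"
      using q_zero_iff quotient(3) by auto
    then show "carrier Q \<noteq> {\<zero>\<^bsub>Q\<^esub>}" by blast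
  next
    fix J assume "brace_ideal J Q"
    then have J: "J \<lhd> add_monoid Q" by (simp add: brace_ideal_def)
    interpret J: normal J "add_monoid Q" by (rule J)
    have J_img: "J = q ` {a \<in> carrier B. q a \<in> J}"
      using J.subset quotient(3) by auto
    have "{a \<in> carrier B. q a \<in> J} \<lhd> add_monoid B"
    proof (rule group.normal_invI[OF add_group])
      show "subgroup {a \<in> carrier B. q a \<in> J} (add_monoid B)"
        using q.hom_mult q.hom_one q.hom_inv J.m_closed J.one_closed J.m_inv_closed
        by unfold_locales (auto simp: a_inv_def[symmetric])
      show "x \<otimes>\<^bsub>add_monoid B\<^esub> a \<otimes>\<^bsub>add_monoid B\<^esub> inv\<^bsub>add_monoid B\<^esub> x \<in> {a \<in> carrier B. q a \<in> J}"
        if "x \<in> carrier (add_monoid B)" "a \<in> {a \<in> carrier B. q a \<in> J}" for x a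
        using that q.hom_mult q.hom_inv J.inv_op_closed2[of "q x" "q a"] q.hom_closed[of x]
        by (auto simp: a_inv_def[symmetric])
    qed
    from normal[OF this] show "J = {\<zero>\<^bsub>Q\<^esub>} \<or> J = carrier Q"
    proof
      assume "{a \<in> carrier B. q a \<in> J} \<subseteq> brace_center B"
      then have "J \<subseteq> {\<zero>\<^bsub>Q\<^esub>}"
        using q_zero_iff by (subst J_img) auto
      then show ?thesis using J.one_closed by auto
    next
      assume "{a \<in> carrier B. q a \<in> J} = carrier B"
      then show ?thesis using J_img quotient(3) by simp
    qed
  qed
qed

lemma quasi_simple_skew_braceI:
  assumes "\<And>N. N \<lhd> add_monoid B \<Longrightarrow> N \<subseteq> brace_center B \<or> N = carrier B"
    and "x \<in> carrier B" "y \<in> carrier B" "x \<oplus> y \<oplus> \<ominus> x \<oplus> \<ominus> y \<notin> brace_center B"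
  shows "quasi_simple_skew_brace B"
proof -
  \<comment> \<open>Otherwise the center would contain the commutator of \<open>x\<close> and
    \<open>y\<close>.\<close>
  have "brace_center B \<noteq> carrier B"
    using assms(2-4) by (metis add.inv_closed add.m_closed)
  with assms show ?thesis
    by (intro quasi_simple_skew_brace.intro quasi_simple_skew_brace_axioms.intro
        skew_brace_axioms perfect_braceI simple_quotient_centerI)
qed

end

section \<open>Skew braces from exact factorizations\<close>

text \<open>For an exact factorization the factors of \<open>a\<close> exist and are unique, so the
  description denotes h b k.\<close>

definition factorization_brace :: "('a, 'm) monoid_scheme \<Rightarrow> 'a set \<Rightarrow> 'a set \<Rightarrow> 'a ring" where
  "factorization_brace G H K =
    \<lparr>carrier = carrier G,
     monoid.mult = (\<lambda>a b. THE c. \<exists>h\<in>H. \<exists>k\<in>K. a = h \<otimes>\<^bsub>G\<^esub> k \<and> c = h \<otimes>\<^bsub>G\<^esub> b \<otimes>\<^bsub>G\<^esub> k),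
     one = \<one>\<^bsub>G\<^esub>, zero = \<one>\<^bsub>G\<^esub>, add = monoid.mult G\<rparr>"

locale exact_factorization = group G + H: subgroup H G + K: subgroup K G
  for G (structure) and H K +
  assumes factor: "a \<in> carrier G \<Longrightarrow> \<exists>h\<in>H. \<exists>k\<in>K. a = h \<otimes> k"
    and inter: "H \<inter> K \<subseteq> {\<one>}"
begin

abbreviation B where "B \<equiv> factorization_brace G H K"

text \<open>The element \<open>inv h' \<otimes> h = k' \<otimes> inv k\<close> lies in both
  subgroups.\<close>

lemma factors_unique:
  assumes "h \<in> H" "k \<in> K" "h' \<in> H" "k' \<in> K" "h \<otimes> k = h' \<otimes> k'"
  shows "h = h'" "k = k'"
proof -
  have c: "h \<in> carrier G" "h' \<in> carrier G" "k \<in> carrier G" "k' \<in> carrier G"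
    using assms by auto
  have "inv h' \<otimes> h = k' \<otimes> inv k"
    using assms(5) c by (metis inv_closed inv_solve_left inv_solve_right m_assoc m_closed)
  moreover have "inv h' \<otimes> h \<in> H" "k' \<otimes> inv k \<in> K" using assms by auto
  ultimately have "inv h' \<otimes> h = \<one>" using inter by auto
  then show "h = h'" using c by (metis inv_closed inv_inv inv_equality)
  then show "k = k'" using assms(5) c by simp
qed

lemma factorization_brace_simps [simp]:
  "carrier B = carrier G" "\<one>\<^bsub>B\<^esub> = \<one>" "\<zero>\<^bsub>B\<^esub> = \<one>" "(\<oplus>\<^bsub>B\<^esub>) = (\<otimes>)"
  by (simp_all add: factorization_brace_def)

lemma factorization_brace_a_inv [simp]: "\<ominus>\<^bsub>B\<^esub> a = inv a"
  by (simp add: a_inv_def m_inv_def factorization_brace_def)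

lemma factorization_brace_mult:
  assumes "h \<in> H" "k \<in> K"
  shows "(h \<otimes> k) \<otimes>\<^bsub>B\<^esub> b = h \<otimes> b \<otimes> k"
  using assms factors_unique
  by (auto simp: factorization_brace_def intro!: the_equality) metis

text \<open>The rule (h k) \<circ> (h' k') = (h h')(k' k) makes this the direct product of
  \<open>H\<close> and the opposite group of \<open>K\<close>.\<close>

lemma group_factorization_brace: "group B"
proof (rule groupI)
  fix a b assume "a \<in> carrier B" "b \<in> carrier B"
  moreover from this obtain h k where "h \<in> H" "k \<in> K" "a = h \<otimes> k" using factor[of a] by auto
  ultimately show "a \<otimes>\<^bsub>B\<^esub> b \<in> carrier B" by (simp add: factorization_brace_mult)
next
  fix a b c assume "a \<in> carrier B" "b \<in> carrier B" and c: "c \<in> carrier B"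
  then obtain h k h' k' where hk: "h \<in> H" "k \<in> K" "a = h \<otimes> k" "h' \<in> H" "k' \<in> K" "b = h' \<otimes> k'"
    using factor by (metis factorization_brace_simps(1))
  then have "a \<otimes>\<^bsub>B\<^esub> b = (h \<otimes> h') \<otimes> (k' \<otimes> k)"
    by (simp add: factorization_brace_mult m_assoc)
  then have "a \<otimes>\<^bsub>B\<^esub> b \<otimes>\<^bsub>B\<^esub> c = (h \<otimes> h') \<otimes> c \<otimes> (k' \<otimes> k)"
    using hk factorization_brace_mult[of "h \<otimes> h'" "k' \<otimes> k" c] by simp
  then show "a \<otimes>\<^bsub>B\<^esub> b \<otimes>\<^bsub>B\<^esub> c = a \<otimes>\<^bsub>B\<^esub> (b \<otimes>\<^bsub>B\<^esub> c)"
    using hk c by (simp add: factorization_brace_mult m_assoc)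
next
  fix a assume a: "a \<in> carrier B"
  then show "\<one>\<^bsub>B\<^esub> \<otimes>\<^bsub>B\<^esub> a = a"
    using factorization_brace_mult[of \<one> \<one> a] by simp
  from a obtain h k where hk: "h \<in> H" "k \<in> K" "a = h \<otimes> k" using factor[of a] by auto
  \<comment> \<open>Inverses are taken factor by factor, so the order is not that of the inverse of
    h k in \<open>G\<close>.\<close>
  then have "(inv h \<otimes> inv k) \<otimes>\<^bsub>B\<^esub> a = \<one>\<^bsub>B\<^esub>"
    by (simp add: factorization_brace_mult m_assoc inv_solve_left')
  then show "\<exists>b\<in>carrier B. b \<otimes>\<^bsub>B\<^esub> a = \<one>\<^bsub>B\<^esub>"
    using hk by (intro bexI[of _ "inv h \<otimes> inv k"]) auto
qed simp

lemma add_monoid_factorization_brace: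
  "add_monoid B = \<lparr>carrier = carrier G, monoid.mult = (\<otimes>), one = \<one>\<rparr>"
  by simp

text \<open>\<open>G\<close> may carry further record fields, so the additive record need not be
  \<open>G\<close> itself and the group axioms are checked for it separately.\<close>

lemma group_add_monoid_factorization_brace: "group (add_monoid B)"
  by (rule groupI) (auto simp: m_assoc intro: exI[of _ "inv _"])

lemma skew_brace_factorization_brace: "skew_brace B"
proof (rule skew_brace.intro[OF group_add_monoid_factorization_brace group_factorization_brace])
  fix a b c assume "a \<in> carrier B" and bc: "b \<in> carrier B" "c \<in> carrier B"
  then obtain h k where hk: "h \<in> H" "k \<in> K" "a = h \<otimes> k" using factor[of a] by auto
  \<comment> \<open>The cancellation of k (h k)^-1 h in right-associated form, as it occurs after
    rewriting with \<open>m_assoc\<close>. It reduces (h b k)(h k)^-1(h c k) to h b c k.\<close>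
  have "k \<otimes> (inv k \<otimes> (inv h \<otimes> (h \<otimes> x))) = x" if "x \<in> carrier G" for x
    using hk(1,2) that by (simp flip: m_assoc)
  then have "h \<otimes> b \<otimes> k \<otimes> inv (h \<otimes> k) \<otimes> (h \<otimes> c \<otimes> k) = h \<otimes> (b \<otimes> c) \<otimes> k"
    using hk(1,2) bc by (simp add: inv_mult_group m_assoc)
  then show "a \<otimes>\<^bsub>B\<^esub> (b \<oplus>\<^bsub>B\<^esub> c) = a \<otimes>\<^bsub>B\<^esub> b \<ominus>\<^bsub>B\<^esub> a \<oplus>\<^bsub>B\<^esub> a \<otimes>\<^bsub>B\<^esub> c"
    using hk by (simp add: factorization_brace_mult a_minus_def)
qed

text \<open>A central \<open>z\<close> in \<open>H\<close> has the factors \<open>z\<close> and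
  \<open>\<one>\<close>, so z \<circ> a = z a; and a \<circ> z = h z k = z h k = z a. Conversely,
  centrality in the additive group is centrality in \<open>G\<close>.\<close>

lemma brace_center_factorization_brace:
  assumes "{z \<in> carrier G. \<forall>a\<in>carrier G. z \<otimes> a = a \<otimes> z} \<subseteq> H"
  shows "brace_center B = {z \<in> carrier G. \<forall>a\<in>carrier G. z \<otimes> a = a \<otimes> z}"
proof -
  interpret B: skew_brace B by (rule skew_brace_factorization_brace)
  have "z \<otimes>\<^bsub>B\<^esub> a = z \<otimes> a \<and> a \<otimes>\<^bsub>B\<^esub> z = z \<otimes> a"
    if z: "z \<in> carrier G" "\<forall>a\<in>carrier G. z \<otimes> a = a \<otimes> z" and a: "a \<in> carrier G" for z a
  proof -
    have "z \<in> H" using z assms by auto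
    then have left: "z \<otimes>\<^bsub>B\<^esub> a = z \<otimes> a"
      using factorization_brace_mult[of z \<one> a] a by simp
    obtain h k where hk: "h \<in> H" "k \<in> K" "a = h \<otimes> k" using factor[OF a] by blast
    then have "a \<otimes>\<^bsub>B\<^esub> z = z \<otimes> h \<otimes> k"
      using z by (simp add: factorization_brace_mult)
    then show ?thesis using left hk z by (simp add: m_assoc)
  qed
  then show ?thesis by (auto simp: B.brace_center_iff)
qed

text \<open>An element \<open>k\<close> of \<open>K\<close> acts by k \<circ> b = b k and an element
  \<open>h\<close> of \<open>H\<close> by h \<circ> b = h b. Hence a noncentral element of
  \<open>K\<close> refutes triviality, and one of \<open>H\<close> almost triviality.\<close>

lemma not_trivial_factorization_brace:
  assumes "k \<in> K" "b \<in> carrier G" "k \<otimes> b \<noteq> b \<otimes> k"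
  shows "\<not> trivial_brace B"
proof
  assume "trivial_brace B"
  then have "k \<otimes>\<^bsub>B\<^esub> b = k \<otimes> b" using assms by (simp add: trivial_brace_def)
  then show False using assms factorization_brace_mult[of \<one> k b] by simp
qed

lemma not_almost_trivial_factorization_brace:
  assumes "h \<in> H" "b \<in> carrier G" "h \<otimes> b \<noteq> b \<otimes> h"
  shows "\<not> almost_trivial_brace B"
proof
  assume "almost_trivial_brace B"
  then have "h \<otimes>\<^bsub>B\<^esub> b = b \<otimes> h" using assms by (simp add: almost_trivial_brace_def)
  then show False using assms factorization_brace_mult[of h \<one> b] by simp
qed

end

section \<open>Normal subgroups of SL(2,5)\<close>

text \<open>As a rewrite rule this reduces statements about the field with five elements to
  instances decided by arithmetic modulo 5.\<close>

lemma all_5: "(\<forall>x :: 5. P x) \<longleftrightarrow> P 0 \<and> P 1 \<and> P 2 \<and> P 3 \<and> P 4"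
proof (intro iffI allI; (elim conjE)?)
  fix x :: 5 assume "P 0" "P 1" "P 2" "P 3" "P 4"
  then show "P x"
  proof (cases x rule: bit1_cases)
    case (of_int z)
    then have "z \<in> {0, 1, 2, 3, 4}" by auto
    with of_int \<open>P 0\<close> \<open>P 1\<close> \<open>P 2\<close> \<open>P 3\<close> \<open>P 4\<close> show ?thesis by auto
  qed
qed simp

text \<open>The group is accessible only through matrix entries, so everything applies to a copy of
  SL(2,5) on any carrier type, in particular on natural numbers.\<close>

locale coordinatized_SL_2_5 =
  fixes G (structure) and E :: "5 \<Rightarrow> 5 \<Rightarrow> 5 \<Rightarrow> 5 \<Rightarrow> 'a"
  assumes carrier_eq: "carrier G = {E a b c d | a b c d. a * d - b * c = 1}"
    and inject [simp]: "E a b c d = E a' b' c' d' \<longleftrightarrow> a = a' \<and> b = b' \<and> c = c' \<and> d = d'"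
    and mult_E: "\<lbrakk>a * d - b * c = 1; a' * d' - b' * c' = 1\<rbrakk> \<Longrightarrow>
      E a b c d \<otimes> E a' b' c' d' =
        E (a * a' + b * c') (a * b' + b * d') (c * a' + d * c') (c * b' + d * d')"
    and one_E: "\<one> = E 1 0 0 1"
begin

lemma carrierE:
  assumes "g \<in> carrier G"
  obtains a b c d where "g = E a b c d" "a * d - b * c = 1"
  using assms unfolding carrier_eq by blast

lemma mem_carrier [simp]: "E a b c d \<in> carrier G \<longleftrightarrow> a * d - b * c = 1"
  unfolding carrier_eq by auto

lemma det_mult:
  fixes a b c d :: 5
  assumes "a * d - b * c = 1" "a' * d' - b' * c' = 1"
  shows "(a * a' + b * c') * (c * b' + d * d') - (a * b' + b * d') * (c * a' + d * c') = 1"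
proof -
  have "(a * a' + b * c') * (c * b' + d * d') - (a * b' + b * d') * (c * a' + d * c')
      = (a * d - b * c) * (a' * d' - b' * c')"
    by (simp add: algebra_simps)
  then show ?thesis using assms by simp
qed

lemma group_G: "group G"
proof (rule groupI)
  fix x y assume "x \<in> carrier G" "y \<in> carrier G"
  then show "x \<otimes> y \<in> carrier G"
    by (elim carrierE) (simp add: mult_E det_mult)
next
  fix x y z assume "x \<in> carrier G" "y \<in> carrier G" "z \<in> carrier G"
  then show "x \<otimes> y \<otimes> z = x \<otimes> (y \<otimes> z)"
    by (elim carrierE) (simp add: mult_E det_mult, simp add: algebra_simps)
next
  fix x assume "x \<in> carrier G"
  then show "\<one> \<otimes> x = x" by (elim carrierE) (simp add: one_E mult_E)
next
  fix x assume "x \<in> carrier G"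
  then obtain a b c d where x: "x = E a b c d" "a * d - b * c = 1" by (rule carrierE)
  then have "E d (- b) (- c) a \<in> carrier G" "E d (- b) (- c) a \<otimes> x = \<one>"
    by (simp_all add: mult_E one_E mult.commute)
  then show "\<exists>y\<in>carrier G. y \<otimes> x = \<one>" by blast
qed (simp add: one_E)

sublocale group G by (rule group_G)

lemma inv_E:
  assumes "a * d - b * c = 1"
  shows "inv (E a b c d) = E d (- b) (- c) a"
  using assms by (intro inv_equality) (simp_all add: mult_E one_E mult.commute)

text \<open>The elementary transvections generate: a matrix with nonzero lower left entry is a
  product upper, lower, upper, and the others reduce to this case.\<close>

lemma subgroup_eq_carrierI:
  assumes N: "subgroup N G" and u: "E 1 1 0 1 \<in> N" and l: "E 1 0 1 1 \<in> N"
  shows "N = carrier G"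
proof -
  interpret N: subgroup N G by (rule N)
  have one_mem: "E 1 0 0 1 \<in> N" using N.one_closed by (simp add: one_E)
  have upper: "E 1 b 0 1 \<in> N" for b
  proof -
    have "E 1 (b + 1) 0 1 \<in> N" if "E 1 b 0 1 \<in> N" for b
      using N.m_closed[OF that u] by (simp add: mult_E add.commute)
    \<comment> \<open>The entries 0 and 1 are given; steps from 1, 2 and 3 reach 2, 3 and 4.\<close>
    from this[of 1] this[of 2] this[of 3] one_mem u
    have "\<forall>b. E 1 b 0 1 \<in> N" by (simp add: all_5)
    then show ?thesis by blast
  qed
  have lower: "E 1 0 c 1 \<in> N" for c
  proof -
    have "E 1 0 (c + 1) 1 \<in> N" if "E 1 0 c 1 \<in> N" for c
      using N.m_closed[OF that l] by (simp add: mult_E add.commute)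
    from this[of 1] this[of 2] this[of 3] one_mem l
    have "\<forall>c. E 1 0 c 1 \<in> N" by (simp add: all_5)
    then show ?thesis by blast
  qed
  have main: "E a b c d \<in> N" if det: "a * d - b * c = 1" and c: "c \<noteq> 0" for a b c d
  proof -
    obtain e where e: "c * e = 1" using five_field[OF c] by blast
    \<comment> \<open>With \<open>e\<close> the inverse of \<open>c\<close>, the parameters (a -
      1)/c and (d - 1)/c are forced by the diagonal entries; the determinant then fixes the upper
      right entry.\<close>
    have "E 1 ((a - 1) * e) 0 1 \<otimes> E 1 0 c 1 \<otimes> E 1 ((d - 1) * e) 0 1 \<in> N"
      by (intro N.m_closed upper lower)
    also have "E 1 ((a - 1) * e) 0 1 \<otimes> E 1 0 c 1 \<otimes> E 1 ((d - 1) * e) 0 1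
      = E (1 + (a - 1) * e * c) ((1 + (a - 1) * e * c) * ((d - 1) * e) + (a - 1) * e) c (c * ((d - 1) * e) + 1)"
      by (simp add: mult_E)
    also have "\<dots> = E a b c d"
    proof -
      have 1: "1 + (a - 1) * e * c = a" using e by (simp add: mult.assoc mult.commute[of e])
      have 2: "c * ((d - 1) * e) + 1 = d" using e by (simp add: mult.left_commute[of c])
      have "a * ((d - 1) * e) + (a - 1) * e = (a * d - 1) * e" by (simp add: algebra_simps)
      also have "\<dots> = b * (c * e)" using det by (simp add: algebra_simps)
      finally show ?thesis unfolding 1 2 using e by simp
    qed
    finally show ?thesis .
  qed
  have "g \<in> N" if "g \<in> carrier G" for g
  proof -
    from that obtain a b c d where g: "g = E a b c d" and det: "a * d - b * c = 1" by (rule carrierE)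
    show ?thesis
    proof (cases "c = 0")
      case True
      then have d: "d \<noteq> 0" using det by auto
      \<comment> \<open>Adding the second column to the first puts the nonzero \<open>d\<close> into
        the lower left corner; the right factor \<open>E 1 0 (-1) 1\<close> undoes this.\<close>
      have "E (a + b) b d d \<in> N"
        using True det d by (intro main) (simp_all add: algebra_simps)
      then have "E (a + b) b d d \<otimes> E 1 0 (-1) 1 \<in> N" using lower by (rule N.m_closed)
      then show ?thesis using g True det by (simp add: mult_E algebra_simps)
    qed (use g det main in auto)
  qed
  then show ?thesis using N.subset by blast
qed

text \<open>Multiples of a nonzero \<open>t\<close> reach 1 modulo 5, and conjugation by a quarter
  turn exchanges upper and lower transvections.\<close>

lemma normal_containing_transvection:
  assumes N: "N \<lhd> G" and u: "E 1 t 0 1 \<in> N" and t: "t \<noteq> 0"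
  shows "N = carrier G"
proof -
  interpret N: normal N G by (rule N)
  have step: "E 1 (b + t) 0 1 \<in> N" if "E 1 b 0 1 \<in> N" for b
    using N.m_closed[OF that u] by (simp add: mult_E add.commute)
  have "\<forall>t. t \<noteq> 0 \<longrightarrow> 1 \<in> {t, t + t, t + t + t, t + t + t + t :: 5}"
    by (simp add: all_5)
  then have "1 \<in> {t, t + t, t + t + t, t + t + t + t}" using t by blast
  then have "E 1 1 0 1 \<in> N"
    using u step[OF u] step[OF step[OF u]] step[OF step[OF step[OF u]]] by auto
  moreover have "E 0 (-1) 1 0 \<otimes> E 1 1 0 1 \<otimes> inv (E 0 (-1) 1 0) \<in> N"
    using \<open>E 1 1 0 1 \<in> N\<close> by (intro N.inv_op_closed2) auto
  then have "E 1 0 (-1) 1 \<in> N" by (simp add: mult_E inv_E)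
  then have "inv (E 1 0 (-1) 1) \<in> N" by (rule N.m_inv_closed)
  then have "E 1 0 1 1 \<in> N" by (simp add: inv_E)
  ultimately show ?thesis
    using subgroup_eq_carrierI N.subgroup_axioms by blast
qed

text \<open>An element with \<open>c \<noteq> 0\<close> is conjugate to one with \<open>d = 0\<close>; the square of its commutator with
  \<open>diag(2, 3)\<close> is then a transvection, nontrivial unless the trace vanishes.\<close>

lemma normal_containing_trace:
  assumes N: "N \<lhd> G" and g: "E a b c d \<in> N" and c: "c \<noteq> 0" and tr: "a + d \<noteq> 0"
  shows "N = carrier G"
proof -
  interpret N: normal N G by (rule N)
  have det: "a * d - b * c = 1" using g N.subset by auto
  obtain e where e: "c * e = 1" using five_field[OF c] by blast
  let ?t = "a + d"
  have six: "6 * x = x" and four: "4 * x = - x" and nine: "9 * x = - x" for x :: 5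
    using all_5[of "\<lambda>x. 6 * x = x"] all_5[of "\<lambda>x. 4 * x = - x"] all_5[of "\<lambda>x. 9 * x = - x"]
    by simp_all
  \<comment> \<open>The shift d/c is the one that clears the lower right entry; trace and
    determinant determine the rest.\<close>
  have "E 1 (d * e) 0 1 \<otimes> E a b c d \<otimes> inv (E 1 (d * e) 0 1) \<in> N"
    using g by (intro N.inv_op_closed2) auto
  also have "E 1 (d * e) 0 1 \<otimes> E a b c d \<otimes> inv (E 1 (d * e) 0 1) = E ?t (- e) c 0"
  proof -
    have 1: "a + d * e * c = ?t" using e by (simp add: mult.assoc mult.commute[of e])
    have 2: "d - c * (d * e) = 0" using e by (simp add: mult.left_commute[of c])
    have "b + d * e * d - ?t * (d * e) = b * (c * e) - a * d * e" using e by (simp add: algebra_simps)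
    also have "\<dots> = - (a * d - b * c) * e" by (simp add: algebra_simps)
    finally have 3: "b + d * e * d - ?t * (d * e) = - e" using det by simp
    show ?thesis using det det_mult[of 1 1 "d * e" 0 a d b c] 1 2 3 by (simp add: mult_E inv_E)
  qed
  finally have h: "E ?t (- e) c 0 \<in> N" .
  have "E 2 0 0 3 \<otimes> E ?t (- e) c 0 \<otimes> inv (E 2 0 0 3) \<otimes> inv (E ?t (- e) c 0) \<in> N"
    using h by (intro N.m_closed N.inv_op_closed2 N.m_inv_closed) auto
  also have "E 2 0 0 3 \<otimes> E ?t (- e) c 0 \<otimes> inv (E 2 0 0 3) \<otimes> inv (E ?t (- e) c 0)
     = E (-1) (2 * ?t * e) 0 (-1)"
  proof -
    have e': "e * c = 1" using e by (simp add: mult.commute)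
    have "E 2 0 0 3 \<otimes> E ?t (- e) c 0 \<otimes> inv (E 2 0 0 3) = E ?t e (- c) 0"
      using e e' four[of e] nine[of c] six[of ?t] by (simp add: mult_E inv_E mult.commute)
    then show ?thesis using e e' by (simp add: mult_E inv_E algebra_simps)
  qed
  finally have k: "E (-1) (2 * ?t * e) 0 (-1) \<in> N" .
  \<comment> \<open>The square has upper right entry -4x, which is x modulo 5.\<close>
  have "E 1 (?t * e) 0 1 \<in> N"
  proof -
    have "E (-1) (2 * x) 0 (-1) \<otimes> E (-1) (2 * x) 0 (-1) = E 1 x 0 1" for x
      using four[of x] by (simp add: mult_E)
    then show ?thesis using N.m_closed[OF k k] by (simp only: mult.assoc)
  qed
  moreover have "c * (?t * e) = ?t" using e by (simp add: mult.left_commute[of c])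
  then have "?t * e \<noteq> 0" using tr by auto
  ultimately show ?thesis using normal_containing_transvection N by blast
qed

text \<open>If the trace vanishes, the commutator with \<open>E 1 1 0 1\<close> has lower left entry
  c^2 and trace 2 + c^2. The latter is nonzero because -2 = 3 is not a square modulo 5, so the case
  of nonzero trace applies.\<close>

lemma normal_containing_lower_left:
  assumes N: "N \<lhd> G" and g: "E a b c d \<in> N" and c: "c \<noteq> 0"
  shows "N = carrier G"
proof (cases "a + d = 0")
  case True
  interpret N: normal N G by (rule N)
  have det: "a * d - b * c = 1" using g N.subset by auto
  have d: "d = - a" using True by (simp add: add_eq_0_iff)
  have "E 1 1 0 1 \<otimes> E a b c d \<otimes> inv (E 1 1 0 1) \<otimes> inv (E a b c d) \<in> N"
    using g by (intro N.m_closed N.inv_op_closed2 N.m_inv_closed) auto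
  also have "E 1 1 0 1 \<otimes> E a b c d \<otimes> inv (E 1 1 0 1) \<otimes> inv (E a b c d)
     = E (1 + a * c + c * c) (1 - a * c - a * a) (c * c) (1 - a * c)"
  proof -
    have det1: "(a + c) * d - (b + d) * c = 1" and det2: "(a + c) * (d - c) - (b + d - (a + c)) * c = 1"
      using det by (simp_all add: algebra_simps)
    have ad: "a * d = 1 + b * c" using det by (simp add: algebra_simps)
    have "E 1 1 0 1 \<otimes> E a b c d \<otimes> E 1 (-1) 0 1 = E (a + c) (b + d - (a + c)) c (d - c)"
      using det det1 by (simp add: mult_E)
    then show ?thesis
      using ad mult_E[OF det2, of d a "- b" "- c"] by (simp add: inv_E det mult.commute) (simp add: algebra_simps)
  qed
  finally have h: "E (1 + a * c + c * c) (1 - a * c - a * a) (c * c) (1 - a * c) \<in> N" .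
  have "\<forall>c :: 5. c \<noteq> 0 \<longrightarrow> c * c \<noteq> 0 \<and> 2 + c * c \<noteq> 0" by (simp add: all_5)
  then have "c * c \<noteq> 0" "(1 + a * c + c * c) + (1 - a * c) \<noteq> 0" using c by auto
  then show ?thesis using normal_containing_trace[OF N h] by blast
next
  case False
  then show ?thesis using assms normal_containing_trace by blast
qed

abbreviation center where
  "center \<equiv> {z \<in> carrier G. \<forall>a\<in>carrier G. z \<otimes> a = a \<otimes> z}"

lemma center_subset_scalars:
  assumes "z \<in> center"
  obtains a where "z = E a 0 0 a" "a * a = 1"
proof -
  from assms have zG: "z \<in> carrier G" and comm: "\<And>a. a \<in> carrier G \<Longrightarrow> z \<otimes> a = a \<otimes> z" by auto
  obtain a b c d where z: "z = E a b c d" and det: "a * d - b * c = 1"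
    using zG by (rule carrierE)
  have "c = 0 \<and> a = d"
    using comm[of "E 1 1 0 1"] det by (auto simp: z mult_E)
  moreover have "b = 0"
    using comm[of "E 1 0 1 1"] det by (auto simp: z mult_E)
  ultimately show ?thesis using that z det by simp
qed

text \<open>In a proper normal subgroup every lower left entry vanishes. Suitable conjugations move
  -b and a - d into that corner, so these vanish too and only scalars remain.\<close>

lemma normal_subset_center_or_eq_carrier:
  assumes N: "N \<lhd> G"
  shows "N \<subseteq> center \<or> N = carrier G"
proof (rule disjCI)
  assume "N \<noteq> carrier G"
  interpret N: normal N G by (rule N)
  have lower_zero: "c = 0" if "E a b c d \<in> N" for a b c d
    using normal_containing_lower_left[OF N that] \<open>N \<noteq> carrier G\<close> by blast
  show "N \<subseteq> center"
  proof
    fix g assume g: "g \<in> N"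
    then obtain a b c d where g_eq: "g = E a b c d" and det: "a * d - b * c = 1"
      using N.subset carrierE by blast
    have c: "c = 0" using lower_zero g g_eq by blast
    have "E 0 (-1) 1 0 \<otimes> g \<otimes> inv (E 0 (-1) 1 0) \<in> N"
      using g by (intro N.inv_op_closed2) auto
    moreover have "d * a - c * b = 1" using det by (simp add: mult.commute)
    ultimately have "E d (- c) (- b) a \<in> N" using det by (simp add: g_eq mult_E inv_E)
    then have b: "b = 0" using lower_zero by fastforce
    have "E 1 0 1 1 \<otimes> g \<otimes> inv (E 1 0 1 1) \<in> N"
      using g by (intro N.inv_op_closed2) auto
    then have "E a 0 (a - d) d \<in> N" using det b c by (simp add: g_eq mult_E inv_E)
    then have d: "d = a" using lower_zero by fastforce
    have "g \<otimes> x = x \<otimes> g" if "x \<in> carrier G" for x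
      using that det by (elim carrierE) (simp add: g_eq b c d mult_E mult.commute)
    then show "g \<in> center" using g N.subset by blast
  qed
qed

section \<open>The exact factorization of SL(2,5)\<close>

text \<open>
  \<open>reg a c\<close> is the element of the normalizer of the quaternion group with first column \<open>(a, c)\<close>.
  A fourth power in the field with five elements tells whether its base vanishes, and \<open>a ^ 3\<close> is
  the inverse of \<open>a\<close> (0 for \<open>a = 0\<close>), so that these polynomials encode a case distinction.
\<close>

definition reg where
  "reg a c = E a (4 * c ^ 3 * (1 + 2 * a ^ 4)) c (a ^ 3 * (1 + 2 * c ^ 4))"

lemma det_reg: "a \<noteq> 0 \<or> c \<noteq> 0 \<Longrightarrow>
    a * (a ^ 3 * (1 + 2 * c ^ 4)) - 4 * c ^ 3 * (1 + 2 * a ^ 4) * c = (1 :: 5)"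
proof -
  have "\<forall>a c :: 5. a \<noteq> 0 \<or> c \<noteq> 0 \<longrightarrow>
      a * (a ^ 3 * (1 + 2 * c ^ 4)) - 4 * c ^ 3 * (1 + 2 * a ^ 4) * c = (1 :: 5)"
    by (simp add: all_5)
  then show "a \<noteq> 0 \<or> c \<noteq> 0 \<Longrightarrow> ?thesis" by blast
qed

text \<open>The elements of order 4 of the quaternion group.\<close>

definition quaternion_units where
  "quaternion_units =
    {E 2 0 0 3, E 3 0 0 2, E 0 4 1 0, E 0 1 4 0, E 0 3 3 0, E 0 2 2 0}"

lemma inv_quaternion_units: "x \<in> quaternion_units \<Longrightarrow> inv x \<in> quaternion_units"
  by (auto simp: quaternion_units_def inv_E)

lemma quaternion_units_subset: "quaternion_units \<subseteq> carrier G"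
  by (simp add: quaternion_units_def)

text \<open>Conjugation commutes with inversion, so one unit from each pair of inverses is checked,
  over all nonzero columns.\<close>

lemma reg_conj_quaternion_units:
  assumes ac: "a \<noteq> 0 \<or> c \<noteq> 0" and x: "x \<in> quaternion_units"
  shows "reg a c \<otimes> x \<otimes> inv (reg a c) \<in> quaternion_units"
proof -
  have "\<forall>a c. a \<noteq> 0 \<or> c \<noteq> 0 \<longrightarrow> reg a c \<otimes> E 2 0 0 3 \<otimes> inv (reg a c) \<in> quaternion_units"
    "\<forall>a c. a \<noteq> 0 \<or> c \<noteq> 0 \<longrightarrow> reg a c \<otimes> E 0 4 1 0 \<otimes> inv (reg a c) \<in> quaternion_units"
    "\<forall>a c. a \<noteq> 0 \<or> c \<noteq> 0 \<longrightarrow> reg a c \<otimes> E 0 3 3 0 \<otimes> inv (reg a c) \<in> quaternion_units"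
    unfolding all_5 by (simp_all add: reg_def mult_E inv_E quaternion_units_def)
  note conj = this[rule_format, OF ac]
  have reg: "reg a c \<in> carrier G" unfolding reg_def mem_carrier using ac by (rule det_reg)
  have inv_conj: "reg a c \<otimes> inv y \<otimes> inv (reg a c) \<in> quaternion_units"
    if "reg a c \<otimes> y \<otimes> inv (reg a c) \<in> quaternion_units" "y \<in> carrier G" for y
    using inv_quaternion_units[OF that(1)] that(2) reg by (simp add: inv_mult_group m_assoc)
  have "inv (E 2 0 0 3) = E 3 0 0 2" "inv (E 0 4 1 0) = E 0 1 4 0" "inv (E 0 3 3 0) = E 0 2 2 0"
    by (simp_all add: inv_E)
  then have "reg a c \<otimes> E 3 0 0 2 \<otimes> inv (reg a c) \<in> quaternion_units"
    "reg a c \<otimes> E 0 1 4 0 \<otimes> inv (reg a c) \<in> quaternion_units"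
    "reg a c \<otimes> E 0 2 2 0 \<otimes> inv (reg a c) \<in> quaternion_units"
    using conj[THEN inv_conj] by simp_all
  note conj = conj this
  have "x = E 2 0 0 3 \<or> x = E 3 0 0 2 \<or> x = E 0 4 1 0 \<or> x = E 0 1 4 0 \<or>
      x = E 0 3 3 0 \<or> x = E 0 2 2 0"
    using x by (simp add: quaternion_units_def)
  then show ?thesis by (elim disjE) (simp_all only: conj)
qed

text \<open>The elements of order 4 generate the quaternion group and conjugation preserves orders,
  so this is its normalizer.\<close>

definition binary_tetrahedral where
  "binary_tetrahedral = {g \<in> carrier G. (\<lambda>x. g \<otimes> x \<otimes> inv g) ` quaternion_units = quaternion_units}"

definition unitriangular where
  "unitriangular = range (\<lambda>t. E 1 t 0 1)"

lemma conj_inj: "g \<in> carrier G \<Longrightarrow> inj_on (\<lambda>x. g \<otimes> x \<otimes> inv g) (carrier G)"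
  by (intro inj_onI) simp

text \<open>An injective map of a finite set into itself is onto.\<close>

lemma binary_tetrahedralI:
  assumes g: "g \<in> carrier G"
    and conj: "\<And>x. x \<in> quaternion_units \<Longrightarrow> g \<otimes> x \<otimes> inv g \<in> quaternion_units"
  shows "g \<in> binary_tetrahedral"
proof -
  have "finite quaternion_units" by (simp add: quaternion_units_def)
  then have "(\<lambda>x. g \<otimes> x \<otimes> inv g) ` quaternion_units = quaternion_units"
    using conj inj_on_subset[OF conj_inj[OF g] quaternion_units_subset]
    by (intro endo_inj_surj) auto
  then show ?thesis using g by (simp add: binary_tetrahedral_def)
qed

lemma subgroup_binary_tetrahedral: "subgroup binary_tetrahedral G"
proof (rule subgroupI)
  have "\<one> \<in> binary_tetrahedral"
    by (rule binary_tetrahedralI) (simp_all add: subsetD[OF quaternion_units_subset])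
  then show "binary_tetrahedral \<noteq> {}" by blast
  fix g assume "g \<in> binary_tetrahedral"
  then have g: "g \<in> carrier G"
    and img: "(\<lambda>x. g \<otimes> x \<otimes> inv g) ` quaternion_units = quaternion_units"
    by (auto simp: binary_tetrahedral_def)
  show "inv g \<in> binary_tetrahedral"
  proof (rule binary_tetrahedralI)
    fix x assume "x \<in> quaternion_units"
    then obtain y where y: "y \<in> quaternion_units" "x = g \<otimes> y \<otimes> inv g"
      using img by blast
    then have "y \<in> carrier G" using quaternion_units_subset by blast
    then have "inv g \<otimes> x \<otimes> inv (inv g) = inv g \<otimes> (g \<otimes> y)"
      using g by (simp add: y(2) m_assoc)
    also have "\<dots> = y" using g \<open>y \<in> carrier G\<close> by (simp flip: m_assoc)
    finally show "inv g \<otimes> x \<otimes> inv (inv g) \<in> quaternion_units" using y(1) by simp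
  qed (use g in simp)
  fix h assume "h \<in> binary_tetrahedral"
  then have h: "h \<in> carrier G" and conj_h: "\<And>x. x \<in> quaternion_units \<Longrightarrow> h \<otimes> x \<otimes> inv h \<in> quaternion_units"
    by (auto simp: binary_tetrahedral_def)
  show "g \<otimes> h \<in> binary_tetrahedral"
  proof (rule binary_tetrahedralI)
    fix x assume x: "x \<in> quaternion_units"
    have "(g \<otimes> h) \<otimes> x \<otimes> inv (g \<otimes> h) = g \<otimes> (h \<otimes> x \<otimes> inv h) \<otimes> inv g"
      using g h subsetD[OF quaternion_units_subset x] by (simp add: m_assoc inv_mult_group)
    then show "(g \<otimes> h) \<otimes> x \<otimes> inv (g \<otimes> h) \<in> quaternion_units"
      using img conj_h[OF x] by auto
  qed (use g h in simp)
qed (auto simp: binary_tetrahedral_def)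

lemma subgroup_unitriangular: "subgroup unitriangular G"
  by (rule subgroupI) (auto simp: unitriangular_def inv_E mult_E)

lemma reg_in_binary_tetrahedral:
  assumes "a \<noteq> 0 \<or> c \<noteq> 0"
  shows "reg a c \<in> binary_tetrahedral"
proof (rule binary_tetrahedralI)
  show "reg a c \<in> carrier G" unfolding reg_def mem_carrier using assms by (rule det_reg)
qed (use assms reg_conj_quaternion_units in blast)

lemma center_subset_binary_tetrahedral: "center \<subseteq> binary_tetrahedral"
proof
  fix z assume "z \<in> center"
  then have z: "z \<in> carrier G" and comm: "\<And>a. a \<in> carrier G \<Longrightarrow> z \<otimes> a = a \<otimes> z" by auto
  have "z \<otimes> x \<otimes> inv z = x" if "x \<in> carrier G" for x
    using that z comm[OF that] by (simp add: m_assoc)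
  then show "z \<in> binary_tetrahedral"
    using z by (intro binary_tetrahedralI) (simp_all add: subsetD[OF quaternion_units_subset])
qed

lemma exact_factorization_SL_2_5: "exact_factorization G binary_tetrahedral unitriangular"
proof (intro exact_factorization.intro exact_factorization_axioms.intro
    group_G subgroup_binary_tetrahedral subgroup_unitriangular)
  fix g assume "g \<in> carrier G"
  then obtain a b c d where g: "g = E a b c d" and det: "a * d - b * c = 1" by (rule carrierE)
  then have ac: "a \<noteq> 0 \<or> c \<noteq> 0" by auto
  \<comment> \<open>The matrices \<open>g\<close> and \<open>reg a c\<close> share their first
    column, so \<open>inv (reg a c) \<otimes> g\<close> fixes the first basis vector; its upper
    right entry is \<open>d0 * b - b0 * d\<close>.\<close>
  obtain b0 d0 where h: "reg a c = E a b0 c d0" by (simp add: reg_def)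
  have det0: "a * d0 - b0 * c = 1" using det_reg[OF ac] h by (simp add: reg_def)
  have b: "a * (d0 * b - b0 * d) + b0 = b"
  proof -
    have "a * (d0 * b - b0 * d) + b0 = (a * d0) * b - b0 * (a * d) + b0" by (simp add: algebra_simps)
    also have "\<dots> = (1 + b0 * c) * b - b0 * (1 + b * c) + b0"
      using det det0 by (simp add: algebra_simps)
    finally show ?thesis by (simp add: algebra_simps)
  qed
  have d: "c * (d0 * b - b0 * d) + d0 = d"
  proof -
    have "c * (d0 * b - b0 * d) + d0 = d0 * (b * c) - (b0 * c) * d + d0" by (simp add: algebra_simps)
    also have "\<dots> = d0 * (a * d - 1) - (a * d0 - 1) * d + d0"
      using det det0 by (simp add: algebra_simps)
    finally show ?thesis by (simp add: algebra_simps)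
  qed
  have "g = reg a c \<otimes> E 1 (d0 * b - b0 * d) 0 1"
    using b d det0 unfolding g h by (simp add: mult_E)
  then show "\<exists>h\<in>binary_tetrahedral. \<exists>k\<in>unitriangular. g = h \<otimes> k"
    using reg_in_binary_tetrahedral[OF ac] by (auto simp: unitriangular_def)
next
  show "binary_tetrahedral \<inter> unitriangular \<subseteq> {\<one>}"
  proof
    fix g assume "g \<in> binary_tetrahedral \<inter> unitriangular"
    then obtain t where t: "g = E 1 t 0 1" and g: "g \<in> binary_tetrahedral"
      by (auto simp: unitriangular_def)
    \<comment> \<open>The conjugate of diag(2, 3) by \<open>g\<close> is upper triangular with the
      same diagonal and upper right entry \<open>t\<close>; the only such unit is diag(2, 3)
      itself.\<close>
    have "E 2 0 0 3 \<in> quaternion_units" by (simp add: quaternion_units_def)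
    then have "g \<otimes> E 2 0 0 3 \<otimes> inv g \<in> quaternion_units"
      using g by (auto simp: binary_tetrahedral_def)
    then have "t * 3 - 2 * t = 0" by (simp add: t mult_E inv_E quaternion_units_def)
    then have "t = 0" by simp
    then show "g \<in> {\<one>}" by (simp add: t one_E)
  qed
qed

section \<open>Properties of the brace on SL(2,5)\<close>

sublocale exact_factorization G binary_tetrahedral unitriangular
  by (rule exact_factorization_SL_2_5)

lemma brace_center_SL_2_5: "brace_center B = center"
  using center_subset_binary_tetrahedral by (rule brace_center_factorization_brace)

lemma quasi_simple_SL_2_5: "quasi_simple_skew_brace B"
proof -
  interpret B: skew_brace B by (rule skew_brace_factorization_brace)
  have "N \<lhd> G" if "N \<lhd> add_monoid B" for N
  proof (rule normal_invI)
    interpret N: normal N "add_monoid B" by (rule that)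
    have inv_eq: "inv\<^bsub>add_monoid B\<^esub> x = inv x" for x
      using factorization_brace_a_inv[of x] unfolding a_inv_def .
    show "subgroup N G"
    proof (rule subgroupI)
      show "inv x \<in> N" if "x \<in> N" for x
        using N.m_inv_closed[OF that] unfolding inv_eq .
    qed (use N.subset N.m_closed N.one_closed in auto)
    show "x \<otimes> h \<otimes> inv x \<in> N" if "x \<in> carrier G" "h \<in> N" for x h
      using N.inv_op_closed2[of x h] that unfolding inv_eq by simp
  qed
  then have "N \<subseteq> brace_center B \<or> N = carrier B" if "N \<lhd> add_monoid B" for N
    using normal_subset_center_or_eq_carrier that by (simp add: brace_center_SL_2_5)
  \<comment> \<open>This commutator is the transvection with entry 3, which is not scalar.\<close>
  moreover have "E 2 0 0 3 \<otimes> E 1 1 0 1 \<otimes> inv (E 2 0 0 3) \<otimes> inv (E 1 1 0 1) \<notin> center"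
  proof
    assume "E 2 0 0 3 \<otimes> E 1 1 0 1 \<otimes> inv (E 2 0 0 3) \<otimes> inv (E 1 1 0 1) \<in> center"
    then obtain a where "E 2 0 0 3 \<otimes> E 1 1 0 1 \<otimes> inv (E 2 0 0 3) \<otimes> inv (E 1 1 0 1) = E a 0 0 a"
      by (rule center_subset_scalars)
    then show False by (simp add: mult_E inv_E)
  qed
  ultimately show ?thesis
    by (intro B.quasi_simple_skew_braceI[of "E 2 0 0 3" "E 1 1 0 1"]) (simp_all add: brace_center_SL_2_5)
qed

text \<open>The law fails for a = \<open>E 1 1 0 1\<close> in \<open>unitriangular\<close> and b = c
  = \<open>E 0 1 4 0\<close> in \<open>binary_tetrahedral\<close>: its right side is c a c, while
  its left side depends on how the product a b factors.\<close>

lemma not_two_sided_SL_2_5: "\<not> two_sided B"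
proof
  have "reg 0 4 = E 0 1 4 0" "reg 4 4 = E 4 3 4 2" by (simp_all add: reg_def)
  then have H: "E 0 1 4 0 \<in> binary_tetrahedral" "E 4 3 4 2 \<in> binary_tetrahedral"
    using reg_in_binary_tetrahedral[of 0 4] reg_in_binary_tetrahedral[of 4 4] by simp_all
  have K: "E 1 t 0 1 \<in> unitriangular" for t by (simp add: unitriangular_def)
  assume "two_sided B"
  then have "(E 1 1 0 1 \<otimes> E 0 1 4 0) \<otimes>\<^bsub>B\<^esub> E 0 1 4 0
    = (E 1 1 0 1 \<otimes>\<^bsub>B\<^esub> E 0 1 4 0) \<otimes> inv (E 0 1 4 0) \<otimes> (E 0 1 4 0 \<otimes>\<^bsub>B\<^esub> E 0 1 4 0)"
    by (simp add: two_sided_def a_minus_def)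
  \<comment> \<open>The first column of the product is (4, 4), so its first factor is
    \<open>reg 4 4\<close>.\<close>
  moreover have "E 1 1 0 1 \<otimes> E 0 1 4 0 = E 4 3 4 2 \<otimes> E 1 2 0 1"
    by (simp add: mult_E)
  then have "(E 1 1 0 1 \<otimes> E 0 1 4 0) \<otimes>\<^bsub>B\<^esub> E 0 1 4 0 = E 4 3 4 2 \<otimes> E 0 1 4 0 \<otimes> E 1 2 0 1"
    using factorization_brace_mult H K by metis
  moreover have "E 1 1 0 1 \<otimes>\<^bsub>B\<^esub> E 0 1 4 0 = E 0 1 4 0 \<otimes> E 1 1 0 1"
    using factorization_brace_mult[of \<one> "E 1 1 0 1" "E 0 1 4 0"] K H by simp
  moreover have "E 0 1 4 0 \<otimes>\<^bsub>B\<^esub> E 0 1 4 0 = E 0 1 4 0 \<otimes> E 0 1 4 0"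
    using factorization_brace_mult[of "E 0 1 4 0" \<one> "E 0 1 4 0"] K H by simp
  ultimately show False by (simp add: mult_E inv_E)
qed

lemma not_trivial_SL_2_5: "\<not> trivial_brace B"
  by (rule not_trivial_factorization_brace[of "E 1 1 0 1" "E 0 1 4 0"])
    (simp_all add: unitriangular_def mult_E)

lemma not_almost_trivial_SL_2_5: "\<not> almost_trivial_brace B"
proof (rule not_almost_trivial_factorization_brace)
  show "reg 0 4 \<in> binary_tetrahedral" by (simp add: reg_in_binary_tetrahedral)
  show "reg 0 4 \<otimes> E 1 1 0 1 \<noteq> E 1 1 0 1 \<otimes> reg 0 4" by (simp add: reg_def mult_E)
qed simp

end

section \<open>Transfer from matrices to natural numbers\<close>

definition matrix_2_2 :: "'a :: zero \<Rightarrow> 'a \<Rightarrow> 'a \<Rightarrow> 'a \<Rightarrow> 'a ^ 2 ^ 2" where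
  "matrix_2_2 a b c d = vector [vector [a, b], vector [c, d]]"

lemma matrix_2_2_nth [simp]:
  "matrix_2_2 a b c d $ 1 $ 1 = a" "matrix_2_2 a b c d $ 1 $ 2 = b"
  "matrix_2_2 a b c d $ 2 $ 1 = c" "matrix_2_2 a b c d $ 2 $ 2 = d"
  by (simp_all add: matrix_2_2_def)

lemma matrix_2_2_eq_iff: "A = B \<longleftrightarrow> A $ 1 $ 1 = B $ 1 $ 1 \<and> A $ 1 $ 2 = B $ 1 $ 2 \<and>
    A $ 2 $ 1 = B $ 2 $ 1 \<and> A $ 2 $ 2 = B $ 2 $ 2" for A B :: "'a ^ 2 ^ 2"
  by (auto simp: vec_eq_iff forall_2)

lemma matrix_2_2_mult:
  fixes a b c d :: "'a :: semiring_1"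
  shows "matrix_2_2 a b c d ** matrix_2_2 a' b' c' d' =
    matrix_2_2 (a * a' + b * c') (a * b' + b * d') (c * a' + d * c') (c * b' + d * d')"
  by (simp add: matrix_2_2_eq_iff matrix_matrix_mult_def sum_2)

lemma matrix_2_2_one: "mat 1 = matrix_2_2 1 0 0 (1 :: 'a :: semiring_1)"
  by (simp add: matrix_2_2_eq_iff mat_def)

theorem mainTheorem6:
  shows "\<exists>B :: nat ring. skew_brace B \<and> finite (carrier B) \<and> add_monoid B \<cong> SL_2_5 \<and>
    quasi_simple_skew_brace B \<and> \<not> two_sided B \<and>
    \<not> trivial_brace B \<and> \<not> almost_trivial_brace B"
proof -
  \<comment> \<open>The matrix type is finite, so it embeds into the natural numbers;
    \<open>G\<close> is the image of SL(2,5) with the operation transported along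
    \<open>f\<close>.\<close>
  have "finite (UNIV :: (5 ^ 2 ^ 2) set)" by simp
  then obtain f :: "5 ^ 2 ^ 2 \<Rightarrow> nat" where f: "inj f"
    using finite_imp_inj_to_nat_seg by blast
  define G where "G = \<lparr>carrier = f ` {A. det A = 1},
    monoid.mult = (\<lambda>x y. f (inv_into UNIV f x ** inv_into UNIV f y)), one = f (mat 1)\<rparr>"
  define E where "E a b c d = f (matrix_2_2 a b c d)" for a b c d
  have matrix: "\<exists>a b c d. A = matrix_2_2 a b c d" for A :: "5 ^ 2 ^ 2"
    by (intro exI) (simp add: matrix_2_2_eq_iff)
  interpret coordinatized_SL_2_5 G E
  proof
    have "{A :: 5 ^ 2 ^ 2. det A = 1} = {matrix_2_2 a b c d | a b c d. a * d - b * c = 1}"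
    proof safe
      fix A :: "5 ^ 2 ^ 2" assume "det A = 1"
      moreover obtain a b c d where "A = matrix_2_2 a b c d" using matrix by blast
      ultimately show "\<exists>a b c d. A = matrix_2_2 a b c d \<and> a * d - b * c = 1"
        by (intro exI[of _ a] exI[of _ b] exI[of _ c] exI[of _ d]) (simp add: det_2)
    qed (simp add: det_2)
    then have "carrier G = f ` {matrix_2_2 a b c d | a b c d. a * d - b * c = 1}"
      by (simp add: G_def)
    then show "carrier G = {E a b c d |a b c d. a * d - b * c = 1}"
      unfolding E_def by blast
  qed (use f in \<open>auto simp: G_def E_def inj_eq matrix_2_2_mult matrix_2_2_one matrix_2_2_eq_iff\<close>)
  let ?B = "factorization_brace G binary_tetrahedral unitriangular"
  have "add_monoid ?B = \<lparr>carrier = carrier G, monoid.mult = monoid.mult G, one = one G\<rparr>"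
    by (rule add_monoid_factorization_brace)
  \<comment> \<open>This \<open>G\<close> has no further record fields, so the additive group is
    literally \<open>G\<close>.\<close>
  also have "\<dots> = G" by (simp add: G_def)
  finally have add_B: "add_monoid ?B = G" .
  have "bij_betw (inv_into UNIV f) (f ` {A. det A = 1}) {A. det A = 1}"
    using f by (rule inj_imp_bij_betw_inv)
  moreover have "inv_into UNIV f \<in> hom G SL_2_5"
    using f by (intro homI) (auto simp: G_def special_linear_group_def)
  ultimately have "inv_into UNIV f \<in> iso (add_monoid ?B) SL_2_5"
    unfolding add_B by (intro isoI) (simp_all add: G_def special_linear_group_def)
  moreover have "finite (carrier G)" by (simp add: G_def)
  then have "finite (carrier ?B)" by simp
  ultimately show ?thesis
    using skew_brace_factorization_brace quasi_simple_SL_2_5 not_two_sided_SL_2_5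
      not_trivial_SL_2_5 not_almost_trivial_SL_2_5
    by (intro exI[of _ ?B]) (auto simp: is_iso_def)
qed

end
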